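(* Let $\Lambda_{n_1n_2}$ be the Lebesgue constant of the tensor product interpolant $\mathcal{I}$ on $[0,2]\times[0,2\pi)$ at the nodes $(y_i,\psi_j)$, $0\le i\le n_1$, $0\le j\le n_2-1$. Then, as $n_1,n_2\to\infty$, $$\Lambda_{n_1n_2}=\mathcal{O}(\log n_1\,\log n_2)$$ in each of the following two cases: (i) $y_i=r_i$ and $\psi_j=\theta_j$, i.e. $n_1+1$ Chebyshev nodes times $n_2$ equispaced nodes; (ii) $y_i=g_1(r_i)$ and $\psi_j=g_2(\theta_j)$, i.e. conformally shifted nodes, with fixed conformal maps $g_1,g_2$ (the constant in $\mathcal{O}$ may depend on $g_1,g_2$).
   Context: Let $r_i=1-\cos(i\pi/n_1)$, $i=0,\dots,n_1$ (Chebyshev points of the second kind in $[0,2]$), and $\theta_j=2\pi j/n_2$, $j=0,\dots,n_2-1$. Let $\delta_0=\delta_{n_1}=1/2$ and $\delta_i=1$ otherwise. Let $\operatorname{cst}=\csc$ if $n_2$ is odd and $\operatorname{cst}=\cot$ if $n_2$ is even. For nodes $0= y_0,\dots,y_{n_1}$ in $[0,2]$ (endpoints included) and $\psi_0,\dots,\psi_{n_2-1}$ in $[0,2\pi)$, define $$b_i^{(1)}(y)=\frac{\frac{(-1)^i\delta_i}{y-y_i}}{\sum_{k=0}^{n_1}\frac{(-1)^k\delta_k}{y-y_k}},\qquad b_j^{(2)}(\psi)=\frac{(-1)^j\operatorname{cst}\left(\frac{\psi-\psi_j}{2}\right)}{\sum_{k=0}^{n_2-1}(-1)^k\operatorname{cst}\left(\frac{\psi-\psi_k}{2}\right)},$$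 extended by continuity at the nodes (so $b_i^{(1)}(y_k)=\delta_{ik}$ and $b_j^{(2)}(\psi_k)=\delta_{jk}$, Kronecker deltas). The tensor product interpolant of $f:[0,2]\times[0,2\pi)\to\mathbb{R}$ is $$\mathcal{I}[f](y,\psi)=\sum_{i=0}^{n_1}\sum_{j=0}^{n_2-1}f(y_i,\psi_j)\,b_i^{(1)}(y)\,b_j^{(2)}(\psi),$$ and its Lebesgue constant is $\Lambda_{n_1n_2}=\sup_{(y,\psi)\in[0,2]\times[0,2\pi)}\sum_{i,j}|b_i^{(1)}(y)|\,|b_j^{(2)}(\psi)|$. The conformal maps: $g_1$ is a conformal (injective holomorphic) map on a complex domain containing $[0,2]$, real on $[0,2]$, with $g_1([0,2])=[0,2]$ and (by orientation) $g_1(0)=0$, $g_1(2)=2$; $g_2$ is a conformal map on a strip $\{|\operatorname{Im}\eta|\le a\}$, $a>0$, real on $\mathbb{R}$, with $g_2([0,2\pi))=[0,2\pi)$ and $g_2(\theta+2\pi)=g_2(\theta)+2\pi$. *)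

theory Defs
  imports "HOL-Analysis.Analysis" "HOL-Library.Landau_Symbols"
begin

definition cheb_node :: "nat \<Rightarrow> nat \<Rightarrow> real" where
  "cheb_node n i = 1 - cos (real i * pi / real n)"

definition equi_node :: "nat \<Rightarrow> nat \<Rightarrow> real" where
  "equi_node n j = 2 * pi * real j / real n"

definition end_weight :: "nat \<Rightarrow> nat \<Rightarrow> real" where
  "end_weight n i = (if i = 0 \<or> i = n then 1 / 2 else 1)"

definition cst :: "nat \<Rightarrow> real \<Rightarrow> real" where
  "cst n x = (if odd n then 1 / sin x else cot x)"

text \<open>
  The barycentric quotients below are undefined at the nodes (in HOL their summands there
  would silently be 0); the first case supplies the values of the continuous
  extension.
\<close>

definition rat_basis :: "nat \<Rightarrow> (nat \<Rightarrow> real) \<Rightarrow> nat \<Rightarrow> real \<Rightarrow> real" where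
  "rat_basis n y i t =
     (if \<exists>k\<le>n. t = y k then (if t = y i then 1 else 0)
      else ((-1) ^ i * end_weight n i / (t - y i)) /
           (\<Sum>k\<le>n. (-1) ^ k * end_weight n k / (t - y k)))"

definition trig_basis :: "nat \<Rightarrow> (nat \<Rightarrow> real) \<Rightarrow> nat \<Rightarrow> real \<Rightarrow> real" where
  "trig_basis n p j \<phi> =
     (if \<exists>k<n. \<phi> = p k then (if \<phi> = p j then 1 else 0)
      else ((-1) ^ j * cst n ((\<phi> - p j) / 2)) /
           (\<Sum>k<n. (-1) ^ k * cst n ((\<phi> - p k) / 2)))"

definition tensor_interpolant ::
  "nat \<Rightarrow> nat \<Rightarrow> (nat \<Rightarrow> real) \<Rightarrow> (nat \<Rightarrow> real) \<Rightarrow> (real \<Rightarrow> real \<Rightarrow> real) \<Rightarrow> real \<Rightarrow> real \<Rightarrow> real" where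
  "tensor_interpolant n1 n2 y p f t \<phi> =
     (\<Sum>i\<le>n1. \<Sum>j<n2. f (y i) (p j) * rat_basis n1 y i t * trig_basis n2 p j \<phi>)"

lemma tensor_interpolant_at_node:
  assumes "inj_on y {..n1}" "inj_on p {..<n2}" "k \<le> n1" "l < n2"
  shows "tensor_interpolant n1 n2 y p f (y k) (p l) = f (y k) (p l)"
proof -
  have 1: "rat_basis n1 y i (y k) = (if i = k then 1 else 0)" if "i \<le> n1" for i
    using assms that by (auto simp: rat_basis_def inj_on_def)
  have 2: "trig_basis n2 p j (p l) = (if j = l then 1 else 0)" if "j < n2" for j
    using assms that by (auto simp: trig_basis_def inj_on_def)
  have "tensor_interpolant n1 n2 y p f (y k) (p l) =
      (\<Sum>i\<le>n1. \<Sum>j<n2. if j = l then (if i = k then f (y i) (p j) else 0) else 0)"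
    unfolding tensor_interpolant_def by (intro sum.cong refl) (auto simp: 1 2)
  also have "\<dots> = f (y k) (p l)"
    using assms by simp
  finally show ?thesis .
qed

text \<open>
  The Lebesgue constant of the operator above. The supremum is taken in the extended reals,
  so that an unbounded Lebesgue function has Lebesgue constant infinity (a real-valued
  supremum would be unspecified there).
\<close>

definition lebesgue_const ::
  "nat \<Rightarrow> nat \<Rightarrow> (nat \<Rightarrow> real) \<Rightarrow> (nat \<Rightarrow> real) \<Rightarrow> ereal" where
  "lebesgue_const n1 n2 y p =
     (SUP (t, \<phi>) \<in> {0..2} \<times> {0..<2 * pi}.
        ereal (\<Sum>i\<le>n1. \<Sum>j<n2. \<bar>rat_basis n1 y i t\<bar> * \<bar>trig_basis n2 p j \<phi>\<bar>))"

definition interval_conformal_map :: "(complex \<Rightarrow> complex) \<Rightarrow> bool" where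
  "interval_conformal_map g \<longleftrightarrow>
     (\<exists>S. open S \<and> connected S \<and> complex_of_real ` {0..2} \<subseteq> S \<and>
          g holomorphic_on S \<and> inj_on g S) \<and>
     g ` complex_of_real ` {0..2} = complex_of_real ` {0..2} \<and>
     g 0 = 0 \<and> g 2 = 2"

text \<open>
  On the closed strip, \<^const>\<open>holomorphic_on\<close> only asks for complex
  differentiability within the strip at its boundary points.
\<close>

definition periodic_conformal_map :: "(complex \<Rightarrow> complex) \<Rightarrow> bool" where
  "periodic_conformal_map g \<longleftrightarrow>
     (\<exists>a>0. g holomorphic_on {z. \<bar>Im z\<bar> \<le> a} \<and> inj_on g {z. \<bar>Im z\<bar> \<le> a}) \<and>
     (\<forall>x::real. g (complex_of_real x) \<in> \<real>) \<and>
     g ` complex_of_real ` {0..<2 * pi} = complex_of_real ` {0..<2 * pi} \<and>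
     (\<forall>x::real. g (complex_of_real (x + 2 * pi)) = g (complex_of_real x) + 2 * complex_of_real pi)"

text \<open>
  The asymptotic bound for an extended-real valued quantity: finite for all large
  arguments, and its real value is big-O. The product filter makes both indices tend to
  infinity jointly and independently.
\<close>

definition bigo_log_log :: "(nat \<Rightarrow> nat \<Rightarrow> ereal) \<Rightarrow> bool" where
  "bigo_log_log L \<longleftrightarrow>
     (\<forall>\<^sub>F (n1, n2) in sequentially \<times>\<^sub>F sequentially. \<bar>L n1 n2\<bar> \<noteq> \<infinity>) \<and>
     (\<lambda>(n1, n2). real_of_ereal (L n1 n2))
       \<in> O[sequentially \<times>\<^sub>F sequentially](\<lambda>(n1, n2). ln (real n1) * ln (real n2))"

end

theory Submission
  imports Defs "HOL-Complex_Analysis.Conformal_Mappings"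
begin

text \<open>
  The Lebesgue function of the tensor product factors, so each univariate interpolant has to be
  bounded by a multiple of $\log n$. The conformal maps enter only through being increasing and
  bi-Lipschitz on the real interval, which preserves the spacing of the nodes up to constants.
  In each barycentric denominator the summands on either side of the evaluation point alternate in
  sign and decrease in modulus with the distance, and the two sides contribute with the same sign.
  Hence the denominator is at least the difference of the two terms nearest to the point, which by
  the spacing of the nodes is of the order of the nearest term. The numerator is at most the nearest terms plus
  a harmonic sum of the same order.
\<close>

section \<open>Alternating sums and elementary estimates\<close>

text \<open>Chebyshev gaps range from order 1/n^2 at the ends to order 1/n in the middle, so no
  single mesh width serves for both numerator and denominator. Distances are therefore measured
  against the gap that contains the evaluation point: k steps beyond an end of that gap means a
  distance of at least k/K such gaps, with K independent of n and of the point. The distance to the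
  nearest node can be arbitrarily small, so numerator and denominator are not bounded separately;
  each part of the numerator is charged to the denominator. The half-angle functions are singular at
  both 0 and pi. On the circle the nodes to the left of the point are moved by one period, so that
  all half-angles lie in (0, pi) in increasing order, and the left neighbour becomes the one nearest
  to pi. This is why the second map is controlled on [0, 4 pi] rather than on one period.\<close>

lemma alternating_sum_bounds:
  fixes a :: "nat \<Rightarrow> real"
  assumes "\<And>i. i < N \<Longrightarrow> 0 \<le> a i" "\<And>i. Suc i < N \<Longrightarrow> a (Suc i) \<le> a i"
  shows "0 \<le> (\<Sum>i<N. (-1) ^ i * a i) \<and> (0 < N \<longrightarrow> (\<Sum>i<N. (-1) ^ i * a i) \<le> a 0)"
  using assms
proof (induction N arbitrary: a)
  case 0
  then show ?case by simp
next
  case (Suc N)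
  have IH: "0 \<le> (\<Sum>i<N. (-1) ^ i * a (Suc i)) \<and>
      (0 < N \<longrightarrow> (\<Sum>i<N. (-1) ^ i * a (Suc i)) \<le> a (Suc 0))"
    by (rule Suc.IH[of "\<lambda>i. a (Suc i)"]) (use Suc.prems in auto)
  \<comment> \<open>Peeling off the first term exchanges the two bounds: nonnegativity of the sum
    uses the upper bound for the tail and conversely, so they are proved as one conjunction.\<close>
  have eq: "(\<Sum>i<Suc N. (-1) ^ i * a i) = a 0 - (\<Sum>i<N. (-1) ^ i * a (Suc i))"
    by (simp add: sum.lessThan_Suc_shift sum_negf del: sum.lessThan_Suc)
  show ?case
    using IH Suc.prems(1)[of 0] Suc.prems(2)[of 0] unfolding eq by (cases "N = 0") auto
qed

text \<open>What remains after the first term is an alternating sum bounded by its own first term.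
  Unlike plain nonnegativity, the bound is comparable to \<open>a 0\<close> as soon as
  \<open>a 1\<close> is smaller by a fixed factor.\<close>

lemma alternating_sum_ge_diff:
  fixes a :: "nat \<Rightarrow> real"
  assumes "2 \<le> N" "\<And>i. i < N \<Longrightarrow> 0 \<le> a i" "\<And>i. Suc i < N \<Longrightarrow> a (Suc i) \<le> a i"
  shows "a 0 - a 1 \<le> (\<Sum>i<N. (-1) ^ i * a i)"
proof -
  obtain M where M: "N = Suc M" "0 < M"
    using assms(1) by (cases N) auto
  have "(\<Sum>i<M. (-1) ^ i * a (Suc i)) \<le> a 1"
    using alternating_sum_bounds[of M "\<lambda>i. a (Suc i)"] assms M by auto
  moreover have "(\<Sum>i<N. (-1) ^ i * a i) = a 0 - (\<Sum>i<M. (-1) ^ i * a (Suc i))"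
    unfolding M by (simp add: sum.lessThan_Suc_shift sum_negf del: sum.lessThan_Suc)
  ultimately show ?thesis by simp
qed

lemma sum_lessThan_add:
  fixes F :: "nat \<Rightarrow> 'a::comm_monoid_add"
  shows "(\<Sum>k<m + n. F k) = (\<Sum>k<m. F k) + (\<Sum>i<n. F (m + i))"
  by (induction n) (simp_all add: add.assoc)

text \<open>The distance \<open>d 0\<close> to the nearest node may be tiny and stays explicit; from
  the next one on the distances grow at least linearly with rate \<open>q\<close>. Enlarging the
  range to \<open>n\<close> gives both sides of the evaluation point the same harmonic
  number.\<close>

lemma sum_inverse_le_harm:
  fixes d :: "nat \<Rightarrow> real"
  assumes "N \<le> Suc n" "0 < q" "\<And>i. 0 < i \<Longrightarrow> i < N \<Longrightarrow> q * real i \<le> d i" "0 < d 0"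
  shows "(\<Sum>i<N. 1 / d i) \<le> 1 / d 0 + harm n / q"
proof -
  have "(\<Sum>i<N. 1 / d i) \<le> (\<Sum>i<N. if i = 0 then 1 / d 0 else 1 / (q * real i))"
  proof (rule sum_mono)
    fix i assume i: "i \<in> {..<N}"
    show "1 / d i \<le> (if i = 0 then 1 / d 0 else 1 / (q * real i))"
    proof (cases "i = 0")
      case False
      then have "0 < q * real i" "q * real i \<le> d i"
        using assms i by auto
      then show ?thesis
        using False by (simp add: frac_le)
    qed simp
  qed
  also have "\<dots> \<le> (\<Sum>i<Suc n. if i = 0 then 1 / d 0 else 1 / (q * real i))"
    by (rule sum_mono2) (use assms in auto)
  also have "\<dots> = 1 / d 0 + harm n / q"
    by (subst sum.lessThan_Suc_shift)
      (simp add: harm_def sum_divide_distrib inverse_eq_divide mult.commute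
        sum.atLeast1_atMost_eq)
  finally show ?thesis .
qed

lemma harm_le_ln: "1 \<le> n \<Longrightarrow> harm n \<le> 1 + ln (real n)"
  using euler_mascheroni_sequence_decreasing[of 1 n]
  by (simp add: harm_expand)

text \<open>Covers evaluation at a node, where the basis functions are Kronecker deltas.\<close>

lemma sum_indicator_le_1:
  assumes "finite A" "inj_on y A"
  shows "(\<Sum>k\<in>A. \<bar>if t = y k then 1 else 0 :: real\<bar>) \<le> 1"
proof (cases "\<exists>k\<in>A. t = y k")
  case True
  then obtain k where k: "k \<in> A" "t = y k" by blast
  have "(\<Sum>i\<in>A. \<bar>if t = y i then 1 else 0 :: real\<bar>) = (\<Sum>i\<in>A. if i = k then 1 else 0)"
    using k assms by (intro sum.cong) (auto simp: inj_on_def)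
  then show ?thesis using k assms by simp
qed (auto intro!: sum_nonpos order_trans[OF _ zero_le_one])

lemma sin_ratio_le:
  assumes "0 \<le> a" "a \<le> b" "b \<le> pi"
  shows "a * sin b \<le> b * sin a"
proof (cases "b = 0")
  case False
  then have b: "0 < b" using assms by simp
  have cvx: "convex_on {0..pi} (\<lambda>x. - sin x)"
    by (rule f''_ge0_imp_convex[where f' = "\<lambda>x. - cos x" and f'' = sin])
      (auto intro!: derivative_eq_intros simp: sin_ge_zero)
  have "- sin ((1 - a / b) *\<^sub>R 0 + (a / b) *\<^sub>R b) \<le> (1 - a / b) * - sin 0 + (a / b) * - sin b"
    by (rule convex_onD[OF cvx]) (use assms b in auto)
  then show ?thesis using b by (simp add: field_simps)
qed (use assms in auto)

lemma sin_ge_jordan: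
  assumes "0 \<le> x" "x \<le> pi / 2"
  shows "2 / pi * x \<le> sin x"
  using sin_ratio_le[of x "pi / 2"] assms by (simp add: field_simps)

lemma obtain_bracket:
  fixes f :: "nat \<Rightarrow> real"
  assumes "f 0 \<le> t" "t < f n"
  obtains j where "j < n" "f j \<le> t" "t < f (Suc j)"
proof -
  have "\<exists>j<n. f j \<le> t \<and> t < f (Suc j)"
    using assms
  proof (induction n)
    case (Suc n)
    then show ?case
      by (cases "t < f n") (auto intro: less_SucI)
  qed simp
  then show ?thesis using that by blast
qed

text \<open>Orientation and both Lipschitz constants in one predicate: restricting to ordered pairs
  removes the absolute values, and \<open>0 < m\<close> forces strict growth.\<close>

definition increasing_bilipschitz :: "real \<Rightarrow> real \<Rightarrow> real set \<Rightarrow> (real \<Rightarrow> real) \<Rightarrow> bool" where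
  "increasing_bilipschitz m M S G \<longleftrightarrow> 0 < m \<and>
     (\<forall>x\<in>S. \<forall>y\<in>S. x \<le> y \<longrightarrow> m * (y - x) \<le> G y - G x \<and> G y - G x \<le> M * (y - x))"

lemma increasing_bilipschitz_bounds:
  assumes "increasing_bilipschitz m M S G" "x \<in> S" "y \<in> S" "x \<le> y"
  shows "m * (y - x) \<le> G y - G x" "G y - G x \<le> M * (y - x)"
  using assms by (auto simp: increasing_bilipschitz_def)

lemma increasing_bilipschitz_const_le:
  assumes "increasing_bilipschitz m M S G" "x \<in> S" "y \<in> S" "x < y"
  shows "m \<le> M"
proof -
  have "m * (y - x) \<le> M * (y - x)"
    using assms unfolding increasing_bilipschitz_def by (meson less_imp_le order_trans)
  then show ?thesis using assms(4) by simp
qed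

lemma increasing_bilipschitz_mono:
  assumes "increasing_bilipschitz m M S G" "x \<in> S" "y \<in> S" "x \<le> y"
  shows "G x \<le> G y"
proof -
  have "0 \<le> m * (y - x)" "m * (y - x) \<le> G y - G x"
    using assms unfolding increasing_bilipschitz_def by auto
  then show ?thesis by linarith
qed

lemma increasing_bilipschitz_strict_mono:
  assumes "increasing_bilipschitz m M S G" "x \<in> S" "y \<in> S" "x < y"
  shows "G x < G y"
proof -
  have "0 < m * (y - x)" "m * (y - x) \<le> G y - G x"
    using assms unfolding increasing_bilipschitz_def by auto
  then show ?thesis by linarith
qed

section \<open>Barycentric rational interpolation at well-spaced nodes\<close>

text \<open>Here \<open>d\<close> lists the distances to the nodes on one side, nearest first, and
  the last weight is the halved one at the endpoint. The reason is 1/d0 - 1/d1 = ((d1 - d0)/d1) /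
  d0, where \<open>gap\<close> bounds the first factor below by 1/(K + 1). A single node has its
  weight halved, which still suffices because K >= 1.\<close>

lemma one_sided_alternating_ge:
  fixes d :: "nat \<Rightarrow> real"
  assumes N: "0 < N" and K: "1 \<le> K" and d0: "0 < d 0"
    and mono: "\<And>i. Suc i < N \<Longrightarrow> d i \<le> d (Suc i)"
    and gap: "2 \<le> N \<Longrightarrow> d 1 \<le> (K + 1) * (d 1 - d 0)"
    and w: "\<And>i. w i = (if Suc i = N then 1 / 2 else 1)"
  shows "1 / (K + 1) / d 0 \<le> (\<Sum>i<N. (-1) ^ i * (w i / d i))"
proof (cases "N = 1")
  case True
  have "1 / (K + 1) \<le> 1 / 2"
    using K by simp
  then have "1 / (K + 1) / d 0 \<le> 1 / 2 / d 0"
    using d0 by (intro divide_right_mono) auto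
  then show ?thesis
    using True by (simp add: w)
next
  case False
  then have N2: "2 \<le> N" using N by auto
  have pos: "0 < d i" if "i < N" for i
    using that by (induction i) (use d0 mono in \<open>auto intro: less_le_trans\<close>)
  have "w 0 / d 0 - w 1 / d 1 \<le> (\<Sum>i<N. (-1) ^ i * (w i / d i))"
  proof (rule alternating_sum_ge_diff[OF N2])
    fix i assume "Suc i < N"
    then show "w (Suc i) / d (Suc i) \<le> w i / d i"
      using pos[of i] mono[of i] by (intro frac_le) (auto simp: w)
  qed (use pos in \<open>auto simp: w less_imp_le\<close>)
  \<comment> \<open>With just two nodes the halved weight falls on \<open>d 1\<close> and makes the
    subtracted term smaller.\<close>
  moreover have "w 0 / d 0 - w 1 / d 1 \<ge> 1 / d 0 - 1 / d 1"
    using False N2 pos[of 1] by (auto simp: w divide_right_mono)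
  moreover have "1 / d 0 - 1 / d 1 \<ge> 1 / (K + 1) / d 0"
  proof -
    have "1 / (K + 1) \<le> (d 1 - d 0) / d 1"
      using gap[OF N2] K pos[of 1] N2 by (simp add: field_simps)
    then have "1 / (K + 1) / d 0 \<le> (d 1 - d 0) / d 1 / d 0"
      using d0 by (intro divide_right_mono) auto
    also have "\<dots> = 1 / d 0 - 1 / d 1"
      using d0 pos[of 1] N2 by (simp add: field_simps)
    finally show ?thesis .
  qed
  ultimately show ?thesis by linarith
qed

text \<open>\<open>left\<close> and \<open>right\<close> compare with the bracketing gap only, which
  suits nodes clustering at the ends. The factor K + 1 is the cost of replacing a nearest term by
  the denominator, 2 counts the sides, and the K in front of \<open>harm n\<close> comes from the
  spacing.\<close>

lemma rat_basis_lebesgue_off_node: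
  fixes y :: "nat \<Rightarrow> real"
  assumes j: "j < n" and t: "y j < t" "t < y (Suc j)" and K: "1 \<le> K"
    and mono: "\<And>i k. i \<le> k \<Longrightarrow> k \<le> n \<Longrightarrow> y i \<le> y k"
    and left: "\<And>k. k < j \<Longrightarrow> real (j - k) * (y (Suc j) - y j) \<le> K * (y j - y k)"
    and right: "\<And>k. Suc j < k \<Longrightarrow> k \<le> n \<Longrightarrow>
                  real (k - Suc j) * (y (Suc j) - y j) \<le> K * (y k - y (Suc j))"
  shows "(\<Sum>k\<le>n. \<bar>rat_basis n y k t\<bar>) \<le> 2 * (K + 1) * (1 + K * harm n)"
proof -
  define h where "h = y (Suc j) - y j"
  define dL where "dL i = t - y (j - i)" for i
  define dR where "dR i = y (Suc j + i) - t" for i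
  \<comment> \<open>Index \<open>j\<close> on the left is node 0 and index \<open>n - j - 1\<close>
    on the right is node \<open>n\<close>, the two nodes of weight 1/2.\<close>
  define wL :: "nat \<Rightarrow> real" where "wL i = (if Suc i = Suc j then 1 / 2 else 1)" for i
  define wR :: "nat \<Rightarrow> real" where "wR i = (if Suc i = n - j then 1 / 2 else 1)" for i
  define D where "D = (\<Sum>k\<le>n. (-1) ^ k * end_weight n k / (t - y k))"
  have h: "0 < h" using t by (simp add: h_def)
  have dL0: "0 < dL 0" "dL 0 \<le> h" and dR0: "0 < dR 0" "dR 0 \<le> h"
    using t by (auto simp: dL_def dR_def h_def)
  have dL_far: "h / K * real i \<le> dL i" if "0 < i" "i < Suc j" for i
  proof -
    have "real i * h \<le> K * (y j - y (j - i))"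
      using left[of "j - i"] that by (simp add: h_def)
    then have "h / K * real i \<le> y j - y (j - i)"
      using K by (simp add: field_simps)
    then show ?thesis using t by (simp add: dL_def)
  qed
  have dR_far: "h / K * real i \<le> dR i" if "0 < i" "i < n - j" for i
  proof -
    have "real i * h \<le> K * (y (Suc j + i) - y (Suc j))"
      using right[of "Suc j + i"] that by (simp add: h_def)
    then have "h / K * real i \<le> y (Suc j + i) - y (Suc j)"
      using K by (simp add: field_simps)
    then show ?thesis using t by (simp add: dR_def)
  qed
  have split: "(\<Sum>k\<le>n. F k) = (\<Sum>i<Suc j. F (j - i)) + (\<Sum>i<n - j. F (Suc j + i))"
    for F :: "nat \<Rightarrow> real"
  proof -
    have "(\<Sum>k\<le>n. F k) = (\<Sum>k<Suc j + (n - j). F k)"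
      using j by (intro sum.cong) auto
    also have "\<dots> = (\<Sum>k<Suc j. F k) + (\<Sum>i<n - j. F (Suc j + i))"
      by (rule sum_lessThan_add)
    also have "(\<Sum>k<Suc j. F k) = (\<Sum>i<Suc j. F (j - i))"
      using sum.nat_diff_reindex[of F "Suc j"] by simp
    finally show ?thesis .
  qed
  \<comment> \<open>On the right, the negative sign of \<open>t - y k\<close> cancels the parity
    shift by one between nodes \<open>j\<close> and \<open>Suc j\<close>; hence both sides enter
    with a plus.\<close>
  have D_eq: "(-1) ^ j * D = (\<Sum>i<Suc j. (-1) ^ i * (wL i / dL i)) + (\<Sum>i<n - j. (-1) ^ i * (wR i / dR i))"
  proof -
    have "(-1) ^ j * ((-1) ^ (j - i) * end_weight n (j - i) / (t - y (j - i))) = (-1) ^ i * (wL i / dL i)"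
      if "i < Suc j" for i
    proof -
      have "(-1) ^ j * (-1) ^ (j - i) = ((-1) ^ i :: real)"
        using that by (auto simp: minus_one_power_iff)
      moreover have "end_weight n (j - i) = wL i"
        using that j by (auto simp: end_weight_def wL_def)
      ultimately show ?thesis
        by (simp add: dL_def mult.assoc[symmetric])
    qed
    moreover have "(-1) ^ j * ((-1) ^ (Suc j + i) * end_weight n (Suc j + i) / (t - y (Suc j + i))) =
        (-1) ^ i * (wR i / dR i)"
      if "i < n - j" for i
    proof -
      have "(-1) ^ j * (-1) ^ (Suc j + i) = - ((-1) ^ i :: real)"
        by (auto simp: minus_one_power_iff)
      moreover have "end_weight n (Suc j + i) = wR i"
        using that j by (auto simp: end_weight_def wR_def)
      moreover have "t - y (Suc j + i) = - dR i"
        by (simp add: dR_def)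
      ultimately show ?thesis
        by (simp add: mult.assoc[symmetric])
    qed
    ultimately show ?thesis
      unfolding D_def split by (simp add: distrib_left sum_distrib_left del: sum.lessThan_Suc)
  qed
  have L: "1 / (K + 1) / dL 0 \<le> (\<Sum>i<Suc j. (-1) ^ i * (wL i / dL i))"
  proof (rule one_sided_alternating_ge)
    show "dL i \<le> dL (Suc i)" if "Suc i < Suc j" for i
      using mono[of "j - Suc i" "j - i"] that j by (simp add: dL_def)
    \<comment> \<open>\<open>dL 0\<close> is less than the bracketing gap, hence at most K times the
      adjacent gap \<open>dL 1 - dL 0\<close>; adding that adjacent gap once more yields K +
      1.\<close>
    assume "2 \<le> Suc j"
    then show "dL 1 \<le> (K + 1) * (dL 1 - dL 0)"
      using left[of "j - 1"] t by (simp add: dL_def algebra_simps)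
  qed (use dL0 K in \<open>auto simp: wL_def\<close>)
  have R: "1 / (K + 1) / dR 0 \<le> (\<Sum>i<n - j. (-1) ^ i * (wR i / dR i))"
  proof (rule one_sided_alternating_ge)
    show "dR i \<le> dR (Suc i)" if "Suc i < n - j" for i
      using mono[of "Suc j + i" "Suc j + Suc i"] that j by (simp add: dR_def)
    assume "2 \<le> n - j"
    then have "h \<le> K * (y (Suc j + 1) - y (Suc j))"
      using right[of "Suc j + 1"] by (simp add: h_def)
    then show "dR 1 \<le> (K + 1) * (dR 1 - dR 0)"
      using t by (simp add: dR_def h_def algebra_simps)
  qed (use j dR0 K in \<open>auto simp: wR_def\<close>)
  have pos: "0 < 1 / (K + 1) / dL 0" "0 < 1 / (K + 1) / dR 0"
    using dL0 dR0 K by auto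
  have "0 < (-1) ^ j * D"
    using D_eq L R pos by linarith
  moreover have "\<bar>(-1) ^ j * D\<bar> = \<bar>D\<bar>"
    by (simp add: abs_mult power_abs)
  ultimately have absD: "\<bar>D\<bar> = (-1) ^ j * D" by simp
  have Dpos: "0 < \<bar>D\<bar>" and DL: "1 / dL 0 \<le> (K + 1) * \<bar>D\<bar>" and DR: "1 / dR 0 \<le> (K + 1) * \<bar>D\<bar>"
  proof -
    show "0 < \<bar>D\<bar>" using D_eq L R pos absD by linarith
    have "1 / (K + 1) / dL 0 \<le> \<bar>D\<bar>" "1 / (K + 1) / dR 0 \<le> \<bar>D\<bar>"
      using D_eq L R pos absD by linarith+
    then have "(K + 1) * (1 / (K + 1) / dL 0) \<le> (K + 1) * \<bar>D\<bar>"
      "(K + 1) * (1 / (K + 1) / dR 0) \<le> (K + 1) * \<bar>D\<bar>"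
      using K by (intro mult_left_mono; simp)+
    then show "1 / dL 0 \<le> (K + 1) * \<bar>D\<bar>" "1 / dR 0 \<le> (K + 1) * \<bar>D\<bar>"
      using K by simp_all
  qed
  have "(\<Sum>k\<le>n. end_weight n k / \<bar>t - y k\<bar>) \<le> (\<Sum>k\<le>n. 1 / \<bar>t - y k\<bar>)"
    by (intro sum_mono divide_right_mono) (auto simp: end_weight_def)
  also have "\<dots> = (\<Sum>i<Suc j. 1 / \<bar>dL i\<bar>) + (\<Sum>i<n - j. 1 / \<bar>dR i\<bar>)"
    unfolding split dL_def dR_def by (simp only: abs_minus_commute)
  also have "\<dots> \<le> (1 / \<bar>dL 0\<bar> + harm n / (h / K)) + (1 / \<bar>dR 0\<bar> + harm n / (h / K))"
  proof (intro add_mono sum_inverse_le_harm)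
    show "h / K * real i \<le> \<bar>dL i\<bar>" if "0 < i" "i < Suc j" for i
      using dL_far[OF that] by linarith
    show "h / K * real i \<le> \<bar>dR i\<bar>" if "0 < i" "i < n - j" for i
      using dR_far[OF that] by linarith
  qed (use j h K dL0 dR0 in auto)
  also have "\<dots> = 1 / dL 0 + 1 / dR 0 + 2 * K * harm n * (1 / h)"
    using dL0 dR0 by simp
  also have "\<dots> \<le> (K + 1) * \<bar>D\<bar> + (K + 1) * \<bar>D\<bar> + 2 * K * harm n * ((K + 1) * \<bar>D\<bar>)"
  proof (intro add_mono mult_left_mono)
    \<comment> \<open>The harmonic part is measured in the bracketing gap, which is at least the
      nearest distance, so 1/h is paid for by the nearest term.\<close>
    have "1 / h \<le> 1 / dL 0" using dL0 h by (simp add: frac_le)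
    then show "1 / h \<le> (K + 1) * \<bar>D\<bar>" using DL by linarith
    show "0 \<le> 2 * K * harm n" using K by (simp add: harm_nonneg)
  qed (use DL DR in auto)
  also have "\<dots> = 2 * (K + 1) * (1 + K * harm n) * \<bar>D\<bar>"
    by (simp add: algebra_simps)
  finally have num: "(\<Sum>k\<le>n. end_weight n k / \<bar>t - y k\<bar>) \<le> 2 * (K + 1) * (1 + K * harm n) * \<bar>D\<bar>" .
  have noteq: "\<not> (\<exists>k\<le>n. t = y k)"
  proof safe
    fix k assume "k \<le> n" "t = y k"
    then show False
      using mono[of k j] mono[of "Suc j" k] t j by (cases "k \<le> j") auto
  qed
  have wpos: "\<bar>end_weight n k\<bar> = end_weight n k" for k
    by (simp add: end_weight_def)
  have "(\<Sum>k\<le>n. \<bar>rat_basis n y k t\<bar>) = (\<Sum>k\<le>n. end_weight n k / \<bar>t - y k\<bar>) / \<bar>D\<bar>"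
    unfolding rat_basis_def D_def[symmetric] sum_divide_distrib using noteq
    by (intro sum.cong refl) (auto simp: abs_mult abs_divide power_abs wpos)
  also have "\<dots> \<le> 2 * (K + 1) * (1 + K * harm n)"
    using num Dpos by (simp add: divide_le_eq)
  finally show ?thesis .
qed

section \<open>Spacing of the Chebyshev nodes\<close>

lemma cheb_node_diff:
  "cheb_node n k - cheb_node n i =
     2 * sin (real (i + k) * (pi / (2 * real n))) * sin ((real k - real i) * (pi / (2 * real n)))"
proof -
  have "(real i * pi / real n + real k * pi / real n) / 2 = real (i + k) * (pi / (2 * real n))"
    by (cases "n = 0") (simp_all add: field_simps)
  moreover have "(real k * pi / real n - real i * pi / real n) / 2 = (real k - real i) * (pi / (2 * real n))"
    by (cases "n = 0") (simp_all add: field_simps)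
  ultimately show ?thesis
    using cos_diff_cos[of "real i * pi / real n" "real k * pi / real n"]
    by (simp only: cheb_node_def)
qed

text \<open>With u = pi/(2n), a difference of nodes is a position factor sin((i + k) u) times a
  length factor sin((k - i) u). The length factors compare with constant pi/2 by Jordan's
  inequality, since (k - i) u <= pi/2; the position factors compare with constant 3 by
  \<open>s\<close>, which depends on the side and is verified separately.\<close>

lemma cheb_node_well_spaced:
  assumes i: "i < k" "k \<le> n" and j: "j < n"
    and s: "sin (real (2 * j + 1) * (pi / (2 * real n))) \<le> 3 * sin (real (i + k) * (pi / (2 * real n)))"
  shows "real (k - i) * (cheb_node n (Suc j) - cheb_node n j) \<le>
           3 * pi / 2 * (cheb_node n k - cheb_node n i)"
proof -
  define u where "u = pi / (2 * real n)"
  have u: "0 < u" "real n * u = pi / 2" using j by (auto simp: u_def)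
  have le: "real l * u \<le> pi" if "l \<le> 2 * n" for l
  proof -
    have "real l * u \<le> real (2 * n) * u"
      using that u by (intro mult_right_mono) auto
    also have "\<dots> = pi" using u by simp
    finally show ?thesis .
  qed
  have ki: "real (k - i) * u \<le> pi / 2"
  proof -
    have "real (k - i) * u \<le> real n * u"
      using i u by (intro mult_right_mono) auto
    then show ?thesis using u by simp
  qed
  have "real (k - i) * sin u \<le> real (k - i) * u"
    using u by (intro mult_left_mono sin_x_le_x) auto
  also have "\<dots> \<le> pi / 2 * sin (real (k - i) * u)"
    using sin_ge_jordan[of "real (k - i) * u"] ki u by (simp add: field_simps)
  finally have s1: "real (k - i) * sin u \<le> pi / 2 * sin (real (k - i) * u)" .
  have "sin (real (2 * j + 1) * u) * (real (k - i) * sin u) \<le>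
      (3 * sin (real (i + k) * u)) * (pi / 2 * sin (real (k - i) * u))"
  proof (rule mult_mono)
    show "0 \<le> 3 * sin (real (i + k) * u)"
      using le[of "i + k"] i u by (simp add: sin_ge_zero)
    show "0 \<le> real (k - i) * sin u"
      using le[of 1] j u by (simp add: sin_ge_zero)
  qed (use s s1 in \<open>auto simp: u_def\<close>)
  moreover have "cheb_node n (Suc j) - cheb_node n j = 2 * sin (real (2 * j + 1) * u) * sin u"
  proof -
    have "j + Suc j = 2 * j + 1" "real (Suc j) - real j = 1" by auto
    then show ?thesis
      using cheb_node_diff[of n "Suc j" j] by (simp only: u_def mult_1)
  qed
  moreover have "cheb_node n k - cheb_node n i = 2 * sin (real (i + k) * u) * sin (real (k - i) * u)"
    using i cheb_node_diff[of n k i] by (simp only: u_def of_nat_diff less_imp_le)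
  ultimately show ?thesis by (simp add: mult_ac)
qed

text \<open>The factor 3 comes from 2j + 1 <= 3 (k + j), with equality at k = 0, j = 1; it bounds
  the ratio of the sines because sin x / x is nonincreasing.\<close>

lemma cheb_node_well_spaced_left:
  assumes "k < j" "j < n"
  shows "real (j - k) * (cheb_node n (Suc j) - cheb_node n j) \<le>
           3 * pi / 2 * (cheb_node n j - cheb_node n k)"
proof (rule cheb_node_well_spaced)
  define u where "u = pi / (2 * real n)"
  have u: "0 < u" "real (2 * n) * u = pi" using assms by (auto simp: u_def)
  have b: "real (2 * j + 1) * u \<le> pi"
  proof -
    have "real (2 * j + 1) * u \<le> real (2 * n) * u"
      using assms u by (intro mult_right_mono) auto
    also have "\<dots> = pi" using u by simp
    finally show ?thesis .
  qed
  have nn: "0 \<le> sin (real (k + j) * u)"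
  proof (rule sin_ge_zero)
    have "real (k + j) * u \<le> real (2 * n) * u"
      using assms u by (intro mult_right_mono) auto
    also have "\<dots> = pi" using u by simp
    finally show "real (k + j) * u \<le> pi" .
  qed (use u in auto)
  have "(real (k + j) * u) * sin (real (2 * j + 1) * u) \<le> (real (2 * j + 1) * u) * sin (real (k + j) * u)"
    by (rule sin_ratio_le) (use assms u b in \<open>auto intro!: mult_right_mono\<close>)
  also have "\<dots> \<le> (real (3 * (k + j)) * u) * sin (real (k + j) * u)"
    using assms u nn by (intro mult_right_mono) auto
  also have "\<dots> = (real (k + j) * u) * (3 * sin (real (k + j) * u))"
    by simp
  finally show "sin (real (2 * j + 1) * (pi / (2 * real n))) \<le> 3 * sin (real (k + j) * (pi / (2 * real n)))"
    using assms u unfolding u_def[symmetric] by (subst (asm) mult_le_cancel_left_pos) auto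
qed (use assms in auto)

text \<open>Reflecting x to pi - x, that is l to 2n - l on the indices, exchanges the ends of the
  interval. The reflected indices \<open>a\<close> and \<open>b\<close> again satisfy b <=
  3a.\<close>

lemma cheb_node_well_spaced_right:
  assumes "Suc j < k" "k \<le> n"
  shows "real (k - Suc j) * (cheb_node n (Suc j) - cheb_node n j) \<le>
           3 * pi / 2 * (cheb_node n k - cheb_node n (Suc j))"
proof (rule cheb_node_well_spaced)
  define u where "u = pi / (2 * real n)"
  define a where "a = 2 * n - (Suc j + k)"
  define b where "b = 2 * n - (2 * j + 1)"
  have u: "0 < u" "real (2 * n) * u = pi" using assms by (auto simp: u_def)
  have ab: "0 < a" "a \<le> b" "b \<le> 3 * a" "b \<le> 2 * n" using assms by (auto simp: a_def b_def)
  have le: "real l * u \<le> pi" if "l \<le> 2 * n" for l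
  proof -
    have "real l * u \<le> real (2 * n) * u"
      using that u by (intro mult_right_mono) auto
    also have "\<dots> = pi" using u by simp
    finally show ?thesis .
  qed
  have refl: "sin (real (2 * n - l) * u) = sin (real l * u)" if "l \<le> 2 * n" for l
  proof -
    have "real (2 * n - l) * u = pi - real l * u"
      using that u by (simp add: of_nat_diff left_diff_distrib)
    then show ?thesis by simp
  qed
  have nn: "0 \<le> sin (real a * u)"
    using le[of a] ab u by (intro sin_ge_zero) auto
  have "(real a * u) * sin (real b * u) \<le> (real b * u) * sin (real a * u)"
    by (rule sin_ratio_le) (use ab u le[of b] in \<open>auto intro!: mult_right_mono\<close>)
  also have "\<dots> \<le> (real (3 * a) * u) * sin (real a * u)"
    using ab u nn by (intro mult_right_mono) (auto simp del: of_nat_mult)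
  also have "\<dots> = (real a * u) * (3 * sin (real a * u))"
    by simp
  finally have "sin (real b * u) \<le> 3 * sin (real a * u)"
    using ab u by (subst (asm) mult_le_cancel_left_pos) auto
  then show "sin (real (2 * j + 1) * (pi / (2 * real n))) \<le> 3 * sin (real (Suc j + k) * (pi / (2 * real n)))"
    unfolding u_def[symmetric] a_def b_def using refl[of "2 * j + 1"] refl[of "Suc j + k"] assms
    by simp
qed (use assms in auto)

lemma cheb_node_mono:
  assumes "i \<le> k" "k \<le> n"
  shows "cheb_node n i \<le> cheb_node n k"
proof (cases "n = 0")
  case False
  then have "cos (real k * pi / real n) \<le> cos (real i * pi / real n)"
    using assms by (intro cos_monotone_0_pi_le divide_right_mono mult_right_mono) (auto simp: field_simps)
  then show ?thesis by (simp add: cheb_node_def)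
qed (use assms in auto)

lemma cheb_node_strict_mono:
  assumes "i < k" "k \<le> n"
  shows "cheb_node n i < cheb_node n k"
proof -
  have "cos (real k * pi / real n) < cos (real i * pi / real n)"
    using assms by (intro cos_monotone_0_pi divide_strict_right_mono mult_strict_right_mono)
      (auto simp: field_simps)
  then show ?thesis by (simp add: cheb_node_def)
qed

lemma cheb_node_bounds: "cheb_node n i \<in> {0..2}"
  by (simp add: cheb_node_def)

text \<open>The cutoff 3 is at least e, so ln n >= 1 absorbs the additive constant 2.\<close>

lemma one_plus_harm_le_ln:
  assumes "3 \<le> n"
  shows "1 + harm n \<le> 3 * ln (real n)"
proof -
  have "exp 1 \<le> real n" using exp_le assms by linarith
  then have "1 \<le> ln (real n)" using assms by (simp add: ln_ge_iff)
  then show ?thesis using harm_le_ln[of n] assms by simp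
qed

text \<open>In \<open>K\<close>, the factor 3 pi/2 is the spacing constant of the Chebyshev nodes
  and M/m the loss under \<open>G\<close>, which stretches the bracketing gap by at most M and the
  distances by at least m. Fixing both endpoints makes 0 and 2 nodes, so every other point is a node
  or strictly bracketed.\<close>

lemma rat_basis_lebesgue_cheb:
  assumes G: "increasing_bilipschitz m M {0..2} G" and G0: "G 0 = 0" "G 2 = 2"
  shows "\<exists>A. \<forall>n\<ge>3. \<forall>t\<in>{0..2}.
           (\<Sum>k\<le>n. \<bar>rat_basis n (\<lambda>i. G (cheb_node n i)) k t\<bar>) \<le> A * ln (real n)"
proof -
  define K where "K = 3 * pi / 2 * (M / m)"
  have m: "0 < m" using G by (simp add: increasing_bilipschitz_def)
  have mM: "m \<le> M" by (rule increasing_bilipschitz_const_le[OF G, of 0 2]) auto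
  have K: "1 \<le> K"
  proof -
    have "1 * 1 \<le> 3 * pi / 2 * (M / m)"
      using m mM pi_gt3 by (intro mult_mono) auto
    then show ?thesis by (simp add: K_def)
  qed
  have bnd: "(\<Sum>k\<le>n. \<bar>rat_basis n (\<lambda>i. G (cheb_node n i)) k t\<bar>) \<le> (2 * (K + 1) * K * 3) * ln (real n)"
    if n: "3 \<le> n" and t: "t \<in> {0..2}" for n t
  proof -
    define y where "y = (\<lambda>i. G (cheb_node n i))"
    have mono: "y i \<le> y k" if "i \<le> k" "k \<le> n" for i k
      unfolding y_def
      by (rule increasing_bilipschitz_mono[OF G]) (use that cheb_node_bounds cheb_node_mono in auto)
    have inj: "inj_on y {..n}"
    proof (rule linorder_inj_onI)
      fix i k assume ik: "i < k" "i \<in> {..n}" "k \<in> {..n}"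
      have "y i < y k"
        unfolding y_def
        by (rule increasing_bilipschitz_strict_mono[OF G])
          (use ik cheb_node_bounds cheb_node_strict_mono in auto)
      then show "y i \<noteq> y k" by simp
    qed auto
    have spaced: "real l * (y (Suc j) - y j) \<le> K * (y k - y i)"
      if "j < n" "i \<le> k" "k \<le> n" and
        r: "real l * (cheb_node n (Suc j) - cheb_node n j) \<le> 3 * pi / 2 * (cheb_node n k - cheb_node n i)"
      for l i j k
    proof -
      have "y (Suc j) - y j \<le> M * (cheb_node n (Suc j) - cheb_node n j)"
        unfolding y_def using cheb_node_bounds cheb_node_mono[of j "Suc j" n] that
        by (intro increasing_bilipschitz_bounds(2)[OF G]) auto
      then have "real l * (y (Suc j) - y j) \<le> real l * (M * (cheb_node n (Suc j) - cheb_node n j))"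
        by (intro mult_left_mono) auto
      also have "\<dots> = M * (real l * (cheb_node n (Suc j) - cheb_node n j))" by simp
      also have "\<dots> \<le> M * (3 * pi / 2 * (cheb_node n k - cheb_node n i))"
        using r m mM by (intro mult_left_mono) auto
      also have "\<dots> = K * (m * (cheb_node n k - cheb_node n i))"
        using m by (simp add: K_def)
      also have "\<dots> \<le> K * (y k - y i)"
        unfolding y_def using cheb_node_bounds cheb_node_mono[of i k n] that K
        by (intro mult_left_mono increasing_bilipschitz_bounds(1)[OF G]) auto
      finally show ?thesis .
    qed
    have y0: "y 0 = 0" "y n = 2" using n G0 by (auto simp: y_def cheb_node_def)
    have H: "0 \<le> (harm n :: real)" by (rule harm_nonneg)
    have "(\<Sum>k\<le>n. \<bar>rat_basis n y k t\<bar>) \<le> 2 * (K + 1) * (1 + K * harm n)"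
    proof (cases "\<exists>k\<le>n. t = y k")
      case True
      then have "(\<Sum>k\<le>n. \<bar>rat_basis n y k t\<bar>) = (\<Sum>k\<le>n. \<bar>if t = y k then 1 else 0\<bar>)"
        by (simp add: rat_basis_def)
      also have "\<dots> \<le> 1" using sum_indicator_le_1[OF _ inj] by simp
      also have "\<dots> \<le> (2 * (K + 1)) * (1 + K * harm n)"
        using mult_mono[of 1 "2 * (K + 1)" 1 "1 + K * harm n"] K H by simp
      finally show ?thesis .
    next
      case False
      then have "y 0 \<le> t" "t < y n" using t y0 n by (auto simp: less_le)
      then obtain j where j: "j < n" "y j \<le> t" "t < y (Suc j)" by (rule obtain_bracket)
      show ?thesis
      proof (rule rat_basis_lebesgue_off_node[where y = y and j = j])
        show "y j < t" using j False by (metis less_le less_imp_le)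
        show "real (j - k) * (y (Suc j) - y j) \<le> K * (y j - y k)" if "k < j" for k
          by (rule spaced) (use that j cheb_node_well_spaced_left in auto)
        show "real (k - Suc j) * (y (Suc j) - y j) \<le> K * (y k - y (Suc j))"
          if "Suc j < k" "k \<le> n" for k
          by (rule spaced) (use that j cheb_node_well_spaced_right in auto)
      qed (use j K mono in auto)
    qed
    also have "\<dots> \<le> 2 * (K + 1) * (K * (1 + harm n))"
      using K H by (intro mult_left_mono) (auto simp: algebra_simps)
    also have "\<dots> \<le> 2 * (K + 1) * (K * (3 * ln (real n)))"
      using K one_plus_harm_le_ln[OF n] by (intro mult_left_mono) auto
    finally show ?thesis by (simp add: y_def algebra_simps)
  qed
  then show ?thesis by blast
qed

section \<open>Trigonometric interpolation at quasi-uniform nodes\<close>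

lemma cst_nonneg: "0 < x \<Longrightarrow> x \<le> pi / 2 \<Longrightarrow> 0 \<le> cst n x"
  by (auto simp: cst_def cot_def intro!: divide_nonneg_nonneg sin_ge_zero cos_ge_zero)

lemma cst_reflect: "cst n (pi - x) = (-1) ^ Suc n * cst n x"
  by (auto simp: cst_def cot_def)

lemma cst_minus: "cst n (- x) = - cst n x"
  by (auto simp: cst_def cot_def)

text \<open>Moving a node by a full period changes the half-angle by pi. The resulting sign
  compensates for (-1)^(k + n) against (-1)^k, so the signed terms are n-periodic in k.\<close>

lemma cst_diff_pi: "cst n (x - pi) = (-1) ^ n * cst n x"
  by (auto simp: cst_def cot_def sin_diff cos_diff)

lemma cst_antimono:
  assumes "0 < x" "x \<le> y" "y \<le> pi / 2"
  shows "cst n y \<le> cst n x"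
proof -
  have s: "0 < sin x" "0 < sin y" "sin x \<le> sin y"
    using assms by (auto intro!: sin_gt_zero sin_monotone_2pi_le)
  have c: "0 \<le> cos y" "cos y \<le> cos x"
    using assms by (auto intro!: cos_ge_zero cos_monotone_0_pi_le)
  show ?thesis
    using s c by (auto simp: cst_def cot_def intro!: frac_le)
qed

text \<open>The bound is (1/x - 1/y)/pi. Over the common denominator sin x * sin y <= x y, the
  difference has numerator sin y - sin x = 2 cos((x + y)/2) sin((y - x)/2), or sin(y - x) for the
  cotangent. The limit pi/3 keeps the cosine at least 1/2, and Jordan's inequality then gives (y -
  x)/pi.\<close>

lemma cst_diff_ge:
  assumes "0 < x" "x \<le> y" "y \<le> pi / 3"
  shows "(y - x) / (pi * x * y) \<le> cst n x - cst n y"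
proof -
  have s: "0 < sin x" "0 < sin y"
    using assms by (auto intro!: sin_gt_zero)
  have ss: "sin x * sin y \<le> x * y"
    using assms s by (intro mult_mono sin_x_le_x) auto
  have num: "(y - x) / pi \<le> (cst n x - cst n y) * (sin x * sin y)"
  proof (cases "odd n")
    case True
    have "1 / 2 \<le> cos ((y + x) / 2)"
      using cos_monotone_0_pi_le[of "(y + x) / 2" "pi / 3"] assms by (simp add: cos_60)
    moreover have "(y - x) / pi \<le> sin ((y - x) / 2)"
      using sin_ge_jordan[of "(y - x) / 2"] assms by (simp add: field_simps)
    ultimately have "(1 / 2) * ((y - x) / pi) \<le> cos ((y + x) / 2) * sin ((y - x) / 2)"
      using assms by (intro mult_mono) auto
    then have "(y - x) / pi \<le> 2 * (cos ((y + x) / 2) * sin ((y - x) / 2))"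
      by linarith
    then have "(y - x) / pi \<le> sin y - sin x"
      by (simp add: sin_diff_sin mult_ac)
    also have "\<dots> = (cst n x - cst n y) * (sin x * sin y)"
      using True s by (simp add: cst_def field_simps)
    finally show ?thesis .
  next
    case False
    have "(y - x) / pi \<le> 2 / pi * (y - x)"
      using assms by (simp add: field_simps)
    also have "\<dots> \<le> sin (y - x)"
      using assms by (intro sin_ge_jordan) auto
    also have "\<dots> = (cst n x - cst n y) * (sin x * sin y)"
      using False s by (simp add: cst_def cot_def sin_diff field_simps)
    finally show ?thesis .
  qed
  have "(y - x) / (pi * x * y) = (y - x) / pi / (x * y)"
    by simp
  also have "\<dots> \<le> (y - x) / pi / (sin x * sin y)"
    using assms s ss by (intro divide_left_mono) auto
  also have "\<dots> \<le> cst n x - cst n y"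
    by (rule pos_divide_le_eq[THEN iffD2, OF _ num]) (use s in simp)
  finally show ?thesis .
qed

text \<open>Jordan's inequality at whichever of 0 and pi is closer. Adding the two reciprocals lets
  the sum over the nodes split into two harmonic sums.\<close>

lemma abs_cst_le:
  assumes "0 < x" "x < pi"
  shows "\<bar>cst n x\<bar> \<le> pi / 2 * (1 / x + 1 / (pi - x))"
proof -
  have s: "0 < sin x" using assms by (simp add: sin_gt_zero)
  have "\<bar>cst n x\<bar> \<le> 1 / sin x"
    using s by (auto simp: cst_def cot_def abs_divide divide_right_mono)
  also have "1 / sin x \<le> pi / 2 * (1 / x + 1 / (pi - x))"
  proof (cases "x \<le> pi / 2")
    case True
    then have "1 / sin x \<le> 1 / (2 / pi * x)"
      using sin_ge_jordan[of x] assms s by (intro divide_left_mono) auto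
    also have "\<dots> = pi / 2 * (1 / x)" by simp
    also have "\<dots> \<le> pi / 2 * (1 / x + 1 / (pi - x))"
      using assms by (intro mult_left_mono) auto
    finally show ?thesis .
  next
    case False
    then have "2 / pi * (pi - x) \<le> sin x"
      using sin_ge_jordan[of "pi - x"] assms by simp
    then have "1 / sin x \<le> 1 / (2 / pi * (pi - x))"
      using assms s by (intro divide_left_mono) auto
    also have "\<dots> = pi / 2 * (1 / (pi - x))" by simp
    also have "\<dots> \<le> pi / 2 * (1 / x + 1 / (pi - x))"
      using assms by (intro mult_left_mono) auto
    finally show ?thesis .
  qed
  finally show ?thesis .
qed

text \<open>\<open>C\<close> bounds x1/(x1 - x0), so 1/x0 - 1/x1 is at least 1/(C x0). The limit
  pi/3 concerns the two nearest terms, whose difference is needed quantitatively; for the others,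
  sign and monotonicity up to pi/2 suffice.\<close>

lemma one_sided_cst_sum_ge:
  assumes N: "2 \<le> N" and x0: "0 < x 0" "x 0 < x 1"
    and mono: "\<And>i. Suc i < N \<Longrightarrow> x i \<le> x (Suc i)"
    and half: "\<And>i. i < N \<Longrightarrow> x i \<le> pi / 2"
    and x1: "x 1 \<le> pi / 3" "x 1 \<le> C * (x 1 - x 0)"
  shows "1 / (pi * C) / x 0 \<le> (\<Sum>i<N. (-1) ^ i * cst n (x i))"
proof -
  have pos: "0 < x i" if "i < N" for i
    using that by (induction i) (use x0 mono in \<open>auto intro: less_le_trans\<close>)
  have C: "0 < C"
  proof (rule ccontr)
    assume "\<not> 0 < C"
    then have "C * (x 1 - x 0) \<le> 0" using x0 by (intro mult_nonpos_nonneg) auto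
    then show False using x0 x1 by linarith
  qed
  have "1 / (pi * C) / x 0 = 1 / C / (pi * x 0)"
    by (simp add: mult_ac)
  also have "\<dots> \<le> ((x 1 - x 0) / x 1) / (pi * x 0)"
    using x0 x1 C by (intro divide_right_mono) (auto simp: field_simps)
  also have "\<dots> = (x 1 - x 0) / (pi * x 0 * x 1)"
    by (simp add: mult_ac)
  also have "\<dots> \<le> cst n (x 0) - cst n (x 1)"
    using x0 x1 by (intro cst_diff_ge) auto
  also have "\<dots> \<le> (\<Sum>i<N. (-1) ^ i * cst n (x i))"
    by (rule alternating_sum_ge_diff[OF N, of "\<lambda>i. cst n (x i)"])
      (use pos half mono in \<open>auto intro!: cst_nonneg cst_antimono\<close>)
  finally show ?thesis .
qed

text \<open>Splitting at $\pi/2$ makes both halves alternating sums of decreasing terms, counted from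
  the nearest singularity ($0$ or $\pi$) of the cotangent or cosecant; the parity convention in
  \<^const>\<open>cst\<close> is what makes their signs agree.\<close>

lemma cst_sum_ratio:
  assumes n: "2 \<le> n" and q: "0 < q" and C: "1 \<le> C" "C * q \<le> pi / 3"
    and ends: "0 < x 0" "x (n - 1) < pi"
    and spaced: "\<And>i k. i \<le> k \<Longrightarrow> k < n \<Longrightarrow> q * real (k - i) \<le> x k - x i"
    and near: "x 1 \<le> C * q" "pi - x (n - 2) \<le> C * q"
  shows "0 < \<bar>\<Sum>i<n. (-1) ^ i * cst n (x i)\<bar>"
    "(\<Sum>i<n. \<bar>cst n (x i)\<bar>) \<le> pi\<^sup>2 * C * (1 + C * harm n) * \<bar>\<Sum>i<n. (-1) ^ i * cst n (x i)\<bar>"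
proof -
  \<comment> \<open>Distances to pi, nearest first: the list \<open>x\<close> read
    backwards.\<close>
  define z where "z k = pi - x (n - Suc k)" for k
  define D where "D = (\<Sum>i<n. (-1) ^ i * cst n (x i))"
  \<comment> \<open>\<open>p\<close> counts the arguments up to pi/2; the disjunct
    \<open>n \<le> i\<close> guarantees that a least index exists.\<close>
  define p where "p = (LEAST i. n \<le> i \<or> pi / 2 < x i)"
  have mono: "x i \<le> x k" if "i \<le> k" "k < n" for i k
  proof -
    have "0 \<le> q * real (k - i)" using q by simp
    then show ?thesis using spaced[OF that] by linarith
  qed
  have pn: "p \<le> n" unfolding p_def by (rule Least_le) simp
  have below: "x i \<le> pi / 2" if "i < p" for i
    using not_less_Least[of i "\<lambda>i. n \<le> i \<or> pi / 2 < x i"] that by (auto simp: p_def)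
  have "n \<le> p \<or> pi / 2 < x p"
    unfolding p_def by (rule LeastI[of _ n]) simp
  then have above: "pi / 2 < x i" if "p \<le> i" "i < n" for i
    using mono[of p i] that by auto
  have x1: "x 1 \<le> pi / 3" using near C by linarith
  have z1: "z 1 \<le> pi / 3" "z 1 \<le> C * q" using near C n by (auto simp: z_def numeral_2_eq_2)
  \<comment> \<open>As pi/3 < pi/2, the second argument from either end lies in its own half, which
    leaves each half the two terms that the difference bound requires.\<close>
  have p2: "2 \<le> p"
  proof (rule ccontr)
    assume "\<not> 2 \<le> p"
    then have "pi / 2 < x 1" using above[of 1] n by auto
    then show False using x1 pi_gt_zero by linarith
  qed
  have pn2: "2 \<le> n - p"
  proof (rule ccontr)
    assume "\<not> 2 \<le> n - p"
    then have "x (n - 2) \<le> pi / 2" using below[of "n - 2"] n by auto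
    then show False using z1 pi_gt_zero n by (simp add: z_def numeral_2_eq_2)
  qed
  have z0: "0 < z 0" using ends by (simp add: z_def)
  have xgap: "q \<le> x 1 - x 0" using spaced[of 0 1] n by simp
  have zgap: "q \<le> z 1 - z 0"
  proof -
    have "n - Suc 0 - (n - Suc 1) = 1" using n by auto
    then show ?thesis using spaced[of "n - Suc 1" "n - Suc 0"] n by (simp add: z_def)
  qed
  have S1: "1 / (pi * C) / x 0 \<le> (\<Sum>i<p. (-1) ^ i * cst n (x i))"
  proof (rule one_sided_cst_sum_ge[OF p2])
    have "C * q \<le> C * (x 1 - x 0)" using xgap C by (intro mult_left_mono) auto
    then show "x 1 \<le> C * (x 1 - x 0)" using near by linarith
  qed (use ends xgap q mono pn below x1 in auto)
  have S2: "1 / (pi * C) / z 0 \<le> (\<Sum>i<n - p. (-1) ^ i * cst n (z i))"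
  proof (rule one_sided_cst_sum_ge[OF pn2])
    have "C * q \<le> C * (z 1 - z 0)" using zgap C by (intro mult_left_mono) auto
    then show "z 1 \<le> C * (z 1 - z 0)" using z1 by linarith
    show "z i \<le> z (Suc i)" if "Suc i < n - p" for i
      using mono[of "n - Suc (Suc i)" "n - Suc i"] that by (simp add: z_def)
    show "z i \<le> pi / 2" if "i < n - p" for i
    proof -
      have "p \<le> n - Suc i" "n - Suc i < n" using that by auto
      then show ?thesis using above[of "n - Suc i"] by (simp add: z_def)
    qed
  qed (use z0 zgap q z1 in auto)
  \<comment> \<open>Reading the upper half backwards produces the sign (-1)^i * (-1)^(n + 1), and
    reflecting x to pi - x in \<open>cst\<close> produces (-1)^(n + 1) once more, which
    cancels.\<close>
  have D_eq: "D = (\<Sum>i<p. (-1) ^ i * cst n (x i)) + (\<Sum>i<n - p. (-1) ^ i * cst n (z i))"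
  proof -
    have "D = (\<Sum>i<p. (-1) ^ i * cst n (x i)) + (\<Sum>i<n - p. (-1) ^ (p + i) * cst n (x (p + i)))"
      unfolding D_def using sum_lessThan_add[of "\<lambda>i. (-1) ^ i * cst n (x i)" p "n - p"] pn by simp
    also have "(\<Sum>i<n - p. (-1) ^ (p + i) * cst n (x (p + i))) =
        (\<Sum>i<n - p. (-1) ^ (p + (n - p - Suc i)) * cst n (x (p + (n - p - Suc i))))"
      by (rule sum.nat_diff_reindex[symmetric])
    also have "\<dots> = (\<Sum>i<n - p. (-1) ^ i * cst n (z i))"
    proof (rule sum.cong)
      fix i assume i: "i \<in> {..<n - p}"
      then have e: "p + (n - p - Suc i) = n - Suc i" by auto
      have "(-1) ^ (n - Suc i) = ((-1) ^ i * (-1) ^ Suc n :: real)"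
        using i by (auto simp: minus_one_power_iff)
      then show "(-1) ^ (p + (n - p - Suc i)) * cst n (x (p + (n - p - Suc i))) = (-1) ^ i * cst n (z i)"
        by (simp only: e z_def cst_reflect mult.assoc)
    qed simp
    finally show ?thesis .
  qed
  have piC: "0 < pi * C" using C by simp
  have pos: "0 < 1 / (pi * C) / x 0" "0 < 1 / (pi * C) / z 0"
    using piC ends z0 by auto
  have Dpos: "0 < D" and DS: "1 / (pi * C) / x 0 \<le> D" "1 / (pi * C) / z 0 \<le> D"
    using S1 S2 D_eq pos by linarith+
  show "0 < \<bar>\<Sum>i<n. (-1) ^ i * cst n (x i)\<bar>"
    using Dpos by (simp add: D_def)
  have Dx: "1 / x 0 \<le> pi * C * D" and Dz: "1 / z 0 \<le> pi * C * D"
  proof -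
    have "(pi * C) * (1 / (pi * C) / x 0) \<le> (pi * C) * D" "(pi * C) * (1 / (pi * C) / z 0) \<le> (pi * C) * D"
      using DS piC by (intro mult_left_mono; simp)+
    then show "1 / x 0 \<le> pi * C * D" "1 / z 0 \<le> pi * C * D"
      using C by simp_all
  qed
  \<comment> \<open>The harmonic part carries 1/q; since x 0 < x 1 <= C q, it costs only another
    factor C over the nearest term.\<close>
  have Dq: "1 / q \<le> C * (pi * C * D)"
  proof -
    have "x 0 \<le> C * q" using near xgap q by linarith
    then have "1 / q \<le> C * (1 / x 0)" using ends q by (simp add: field_simps)
    also have "\<dots> \<le> C * (pi * C * D)" using Dx C by (intro mult_left_mono) auto
    finally show ?thesis .
  qed
  have inv_x: "(\<Sum>i<n. 1 / x i) \<le> 1 / x 0 + harm n / q"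
  proof (rule sum_inverse_le_harm)
    show "q * real i \<le> x i" if "i < n" for i
      using spaced[of 0 i] that ends by simp
  qed (use q ends in auto)
  have inv_z: "(\<Sum>i<n. 1 / z i) \<le> 1 / z 0 + harm n / q"
  proof (rule sum_inverse_le_harm)
    show "q * real i \<le> z i" if "i < n" for i
    proof -
      have "n - 1 - (n - Suc i) = i" "n - Suc i \<le> n - 1" "n - 1 < n" using that by auto
      then show ?thesis
        using spaced[of "n - Suc i" "n - 1"] that ends by (simp add: z_def)
    qed
  qed (use q z0 in auto)
  have range: "0 < x i" "x i < pi" if "i < n" for i
  proof -
    have "i \<le> n - 1" "n - 1 < n" using that by auto
    then show "0 < x i" "x i < pi"
      using mono[of 0 i] mono[of i "n - 1"] that ends by auto
  qed
  have H: "0 \<le> (harm n :: real)" by (rule harm_nonneg)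
  have "(\<Sum>i<n. \<bar>cst n (x i)\<bar>) \<le> (\<Sum>i<n. pi / 2 * (1 / x i + 1 / (pi - x i)))"
    using range by (intro sum_mono abs_cst_le) auto
  also have "\<dots> = pi / 2 * ((\<Sum>i<n. 1 / x i) + (\<Sum>i<n. 1 / (pi - x i)))"
    by (simp only: sum.distrib flip: sum_distrib_left)
  also have "(\<Sum>i<n. 1 / (pi - x i)) = (\<Sum>i<n. 1 / z i)"
    unfolding z_def by (rule sum.nat_diff_reindex[symmetric])
  also have "pi / 2 * ((\<Sum>i<n. 1 / x i) + (\<Sum>i<n. 1 / z i)) \<le>
      pi / 2 * ((pi * C * D + harm n * (C * (pi * C * D))) + (pi * C * D + harm n * (C * (pi * C * D))))"
  proof (intro mult_left_mono add_mono)
    have "harm n / q \<le> harm n * (C * (pi * C * D))"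
      using mult_left_mono[OF Dq H] by simp
    then show "(\<Sum>i<n. 1 / x i) \<le> pi * C * D + harm n * (C * (pi * C * D))"
      "(\<Sum>i<n. 1 / z i) \<le> pi * C * D + harm n * (C * (pi * C * D))"
      using inv_x inv_z Dx Dz by linarith+
  qed auto
  also have "\<dots> = pi\<^sup>2 * C * (1 + C * harm n) * D"
    by (simp add: field_simps power2_eq_square)
  finally show "(\<Sum>i<n. \<bar>cst n (x i)\<bar>) \<le> pi\<^sup>2 * C * (1 + C * harm n) * \<bar>\<Sum>i<n. (-1) ^ i * cst n (x i)\<bar>"
    using Dpos by (simp add: D_def)
qed

section \<open>Trigonometric basis at mapped equispaced nodes\<close>

lemma sum_periodic_shift:
  fixes F :: "nat \<Rightarrow> real"
  assumes "\<And>k. F (k + n) = F k"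
  shows "(\<Sum>i<n. F (s + i)) = (\<Sum>i<n. F i)"
proof (induction s)
  case (Suc s)
  have "(\<Sum>i<Suc n. F (s + i)) = F s + (\<Sum>i<n. F (Suc s + i))"
    by (subst sum.lessThan_Suc_shift) simp
  moreover have "(\<Sum>i<Suc n. F (s + i)) = (\<Sum>i<n. F (s + i)) + F s"
    using assms[of s] by simp
  ultimately show ?case using Suc by simp
qed simp

text \<open>\<open>q\<close> is pi/n stretched by m, a lower bound for the half-angle between
  neighbouring nodes, while C q = 2 pi M/n bounds a full gap from above. The second half-angle from
  either end spans at most two gaps, halved, so C q bounds it as well.\<close>

lemma trig_basis_lebesgue_equi:
  assumes G: "increasing_bilipschitz m M {0..4 * pi} G" and G0: "G 0 = 0"
    and per: "\<And>\<theta>. G (\<theta> + 2 * pi) = G \<theta> + 2 * pi"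
  shows "\<exists>A N. \<forall>n\<ge>N. \<forall>\<phi>\<in>{0..<2 * pi}.
           (\<Sum>k<n. \<bar>trig_basis n (\<lambda>j. G (equi_node n j)) k \<phi>\<bar>) \<le> A * ln (real n)"
proof -
  define C where "C = 2 * M / m"
  have m: "0 < m" using G by (simp add: increasing_bilipschitz_def)
  have mM: "m \<le> M" by (rule increasing_bilipschitz_const_le[OF G, of 0 1]) (use pi_gt3 in auto)
  have C: "1 \<le> C" using m mM by (simp add: C_def)
  \<comment> \<open>For n >= 6 M one has C q = 2 pi M/n <= pi/3, the range in which the difference
    bound for \<open>cst\<close> holds.\<close>
  obtain N0 :: nat where N0: "6 * M \<le> real N0" using real_arch_simple by blast
  have bnd: "(\<Sum>k<n. \<bar>trig_basis n (\<lambda>j. G (equi_node n j)) k \<phi>\<bar>) \<le> (pi\<^sup>2 * C * C * 3) * ln (real n)"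
    if n3: "max 3 N0 \<le> n" and phi: "\<phi> \<in> {0..<2 * pi}" for n \<phi>
  proof -
    have n: "3 \<le> n" "6 * M \<le> real n" using n3 N0 by auto
    define p where "p = (\<lambda>j. G (equi_node n j))"
    define q where "q = m * pi / real n"
    have q: "0 < q" using m n by (simp add: q_def)
    have node: "equi_node n k \<in> {0..4 * pi}" if "k \<le> 2 * n" for k
    proof -
      have "pi * real k \<le> pi * real (2 * n)" using that by (intro mult_left_mono) auto
      then show ?thesis using n by (simp add: equi_node_def field_simps)
    qed
    have node_diff: "equi_node n k - equi_node n i = 2 * pi * real (k - i) / real n" if "i \<le> k" for i k
      using that by (simp add: equi_node_def of_nat_diff right_diff_distrib diff_divide_distrib)
    have node_le: "equi_node n i \<le> equi_node n k" if "i \<le> k" for i k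
      using that by (simp add: equi_node_def divide_right_mono)
    have lower: "2 * q * real (k - i) \<le> p k - p i" if "i \<le> k" "k \<le> 2 * n" for i k
    proof -
      have "m * (equi_node n k - equi_node n i) \<le> p k - p i"
        unfolding p_def using that node node_le
        by (intro increasing_bilipschitz_bounds(1)[OF G]) auto
      then show ?thesis using that by (simp add: node_diff q_def mult_ac)
    qed
    have upper: "p k - p i \<le> C * q * real (k - i)" if "i \<le> k" "k \<le> 2 * n" for i k
    proof -
      have "p k - p i \<le> M * (equi_node n k - equi_node n i)"
        unfolding p_def using that node node_le
        by (intro increasing_bilipschitz_bounds(2)[OF G]) auto
      then show ?thesis using that m by (simp add: node_diff q_def C_def mult_ac)
    qed
    have p_per: "p (k + n) = p k + 2 * pi" for k
    proof -
      have "equi_node n (k + n) = equi_node n k + 2 * pi"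
        using n by (simp add: equi_node_def field_simps)
      then show ?thesis by (simp add: p_def per)
    qed
    have p0: "p 0 = 0" "p n = 2 * pi"
      using p_per[of 0] G0 by (auto simp: p_def equi_node_def)
    have strict: "p i < p k" if "i < k" "k \<le> 2 * n" for i k
    proof -
      have "0 < 2 * q * real (k - i)" using that q by simp
      then show ?thesis using lower[of i k] that by linarith
    qed
    have H: "0 \<le> (harm n :: real)" by (rule harm_nonneg)
    have "(\<Sum>k<n. \<bar>trig_basis n p k \<phi>\<bar>) \<le> pi\<^sup>2 * C * (1 + C * harm n)"
    proof (cases "\<exists>k<n. \<phi> = p k")
      case True
      have inj: "inj_on p {..<n}"
      proof (rule linorder_inj_onI)
        show "p i \<noteq> p k" if "i < k" "i \<in> {..<n}" "k \<in> {..<n}" for i k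
          using strict[of i k] that by simp
      qed auto
      have "(\<Sum>k<n. \<bar>trig_basis n p k \<phi>\<bar>) = (\<Sum>k<n. \<bar>if \<phi> = p k then 1 else 0\<bar>)"
        using True by (simp add: trig_basis_def)
      also have "\<dots> \<le> 1" using sum_indicator_le_1[OF _ inj] by simp
      also have "1 \<le> (pi\<^sup>2 * C) * (1 + C * harm n)"
      proof -
        have "1 \<le> pi\<^sup>2" using pi_gt3 by (intro one_le_power) auto
        then have "1 * 1 \<le> pi\<^sup>2 * C" using C by (intro mult_mono) auto
        then show ?thesis
          using mult_mono[of 1 "pi\<^sup>2 * C" 1 "1 + C * harm n"] C H by simp
      qed
      finally show ?thesis .
    next
      case False
      have "p 0 \<le> \<phi>" "\<phi> < p n" using phi p0 by auto
      then obtain j where j: "j < n" "p j \<le> \<phi>" "\<phi> < p (Suc j)" by (rule obtain_bracket)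
      then have j': "p j < \<phi>" using False by (auto simp: less_le)
      \<comment> \<open>Half-angles to n consecutive nodes, beginning with the first one to the
        right of the point; the indices stay below 2n.\<close>
      define x where "x i = (p (Suc j + i) - \<phi>) / 2" for i
      define T where "T k = (-1) ^ k * cst n ((\<phi> - p k) / 2)" for k
      have T_per: "T (k + n) = T k" for k
      proof -
        have "(\<phi> - p (k + n)) / 2 = (\<phi> - p k) / 2 - pi"
          by (simp add: p_per)
        then have "T (k + n) = ((-1) ^ (k + n) * (-1) ^ n) * cst n ((\<phi> - p k) / 2)"
          by (simp only: T_def cst_diff_pi mult.assoc)
        also have "(-1) ^ (k + n) * (-1) ^ n = ((-1) ^ k :: real)"
          by (auto simp: minus_one_power_iff)
        finally show ?thesis by (simp add: T_def)
      qed
      have T_x: "T (Suc j + i) = (-1) ^ j * ((-1) ^ i * cst n (x i))" for i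
      proof -
        have "(\<phi> - p (Suc j + i)) / 2 = - x i" by (simp add: x_def field_simps)
        then show ?thesis by (simp only: T_def cst_minus) (simp add: power_add)
      qed
      have D: "\<bar>\<Sum>k<n. T k\<bar> = \<bar>\<Sum>i<n. (-1) ^ i * cst n (x i)\<bar>"
      proof -
        have "(\<Sum>k<n. T k) = (\<Sum>i<n. T (Suc j + i))"
          by (rule sum_periodic_shift[symmetric]) (rule T_per)
        also have "\<dots> = (-1) ^ j * (\<Sum>i<n. (-1) ^ i * cst n (x i))"
          by (simp only: T_x sum_distrib_left)
        finally show ?thesis by (simp add: abs_mult power_abs)
      qed
      have absT: "(\<Sum>k<n. \<bar>T k\<bar>) = (\<Sum>i<n. \<bar>cst n (x i)\<bar>)"
      proof -
        have "\<bar>T (Suc j + i)\<bar> = \<bar>cst n (x i)\<bar>" for i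
          by (simp only: T_x) (simp add: abs_mult power_abs)
        moreover have "(\<Sum>i<n. \<bar>T (Suc j + i)\<bar>) = (\<Sum>k<n. \<bar>T k\<bar>)"
          by (rule sum_periodic_shift) (simp add: T_per)
        ultimately show ?thesis by (simp only:)
      qed
      \<comment> \<open>The last node of the window is the left neighbour one period later, so
        \<open>pi - x (n - 1)\<close> is half the distance to that neighbour.\<close>
      have pj: "p (Suc j + (n - 1)) = p j + 2 * pi"
        using p_per[of j] n by (simp add: add.commute)
      have main: "2 \<le> n" "C * q \<le> pi / 3" "0 < x 0" "x (n - 1) < pi" "x 1 \<le> C * q" "pi - x (n - 2) \<le> C * q"
        "\<And>i k. i \<le> k \<Longrightarrow> k < n \<Longrightarrow> q * real (k - i) \<le> x k - x i"
      proof -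
        show "2 \<le> n" using n by simp
        show "C * q \<le> pi / 3" using n m by (simp add: C_def q_def field_simps)
        show "0 < x 0" using j by (simp add: x_def)
        show "x (n - 1) < pi" unfolding x_def pj using j' by simp
        have "p (Suc j + 1) - p j \<le> C * q * 2" using upper[of j "Suc j + 1"] j n by simp
        then show "x 1 \<le> C * q" using j' by (simp add: x_def)
        \<comment> \<open>The gap to the left of \<open>p j\<close> is taken one period later, which
          avoids the index j - 1 when j = 0.\<close>
        have "p (Suc j + (n - 1)) - p (Suc j + (n - 2)) \<le> C * q * 1"
          using upper[of "Suc j + (n - 2)" "Suc j + (n - 1)"] j n by (simp add: Suc_diff_le numeral_2_eq_2)
        moreover have "p (Suc j) - p j \<le> C * q * 1" using upper[of j "Suc j"] j by simp
        ultimately show "pi - x (n - 2) \<le> C * q" using j unfolding x_def pj by (simp add: field_simps)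
        show "q * real (k - i) \<le> x k - x i" if "i \<le> k" "k < n" for i k
          using lower[of "Suc j + i" "Suc j + k"] that j by (simp add: x_def field_simps)
      qed
      note ratio = cst_sum_ratio[OF main(1) q C main(2-4) main(7) main(5,6)]
      have "trig_basis n p k \<phi> = T k / (\<Sum>k<n. T k)" for k
        by (simp only: trig_basis_def if_not_P[OF False] T_def)
      then have "(\<Sum>k<n. \<bar>trig_basis n p k \<phi>\<bar>) = (\<Sum>k<n. \<bar>T k\<bar>) / \<bar>\<Sum>k<n. T k\<bar>"
        by (simp add: sum_divide_distrib)
      also have "\<dots> \<le> pi\<^sup>2 * C * (1 + C * harm n)"
        using ratio by (simp add: D absT divide_le_eq)
      finally show ?thesis .
    qed
    also have "\<dots> \<le> pi\<^sup>2 * C * (C * (1 + harm n))"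
      using C H by (intro mult_left_mono) (auto simp: algebra_simps)
    also have "\<dots> \<le> pi\<^sup>2 * C * (C * (3 * ln (real n)))"
      using C one_plus_harm_le_ln[OF n(1)] by (intro mult_left_mono) auto
    finally show ?thesis by (simp add: p_def algebra_simps)
  qed
  then show ?thesis by blast
qed

section \<open>Conformal maps on real intervals\<close>

text \<open>A holomorphic function is Lipschitz on compact convex sets; applied to the map and to its
  holomorphic inverse this gives both bounds.\<close>

lemma holomorphic_lipschitz_on_compact_convex:
  assumes "open S" "f holomorphic_on S" "compact K" "convex K" "K \<subseteq> S"
  obtains B where "0 < B" "\<And>x y. x \<in> K \<Longrightarrow> y \<in> K \<Longrightarrow> cmod (f x - f y) \<le> B * cmod (x - y)"
proof -
  have "continuous_on K (deriv f)"
    using assms holomorphic_deriv holomorphic_on_imp_continuous_on continuous_on_subset by blast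
  then have "bounded (deriv f ` K)"
    using assms compact_continuous_image compact_imp_bounded by blast
  then obtain B where B: "0 < B" "\<And>z. z \<in> K \<Longrightarrow> cmod (deriv f z) \<le> B"
    by (auto simp: bounded_pos)
  show ?thesis
  proof (rule that[OF B(1)])
    fix x y assume "x \<in> K" "y \<in> K"
    then show "cmod (f x - f y) \<le> B * cmod (x - y)"
    proof (intro field_differentiable_bound[OF assms(4), where f' = "deriv f"])
      fix z assume "z \<in> K"
      then show "(f has_field_derivative deriv f z) (at z within K)"
        using assms by (meson holomorphic_derivI has_field_derivative_at_within subsetD)
    qed (use B in auto)
  qed
qed

text \<open>Order comes first: a continuous injective real function on an interval is monotone, and
  \<open>inc\<close> fixes the direction. This places the image of the segment in [G a, G b], where
  the Lipschitz constant B of the inverse gives the lower constant 1/B.\<close>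

lemma conformal_increasing_bilipschitz:
  assumes S: "open S" and hol: "g holomorphic_on S" and inj: "inj_on g S"
    and sub: "complex_of_real ` {a..b} \<subseteq> S" and ab: "a < b"
    and real: "\<And>x. x \<in> {a..b} \<Longrightarrow> g (of_real x) \<in> \<real>"
    and inc: "Re (g (of_real a)) < Re (g (of_real b))"
  obtains m M where "increasing_bilipschitz m M {a..b} (\<lambda>x. Re (g (of_real x)))"
proof -
  define G where "G x = Re (g (of_real x))" for x
  have gG: "g (of_real x) = of_real (G x)" if "x \<in> {a..b}" for x
    using real[OF that] by (simp add: G_def of_real_Re)
  have contG: "continuous_on {a..b} G"
  proof -
    have "continuous_on (complex_of_real ` {a..b}) g"
      using hol sub holomorphic_on_imp_continuous_on continuous_on_subset by blast
    then have "continuous_on {a..b} (\<lambda>x. g (of_real x))"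
      by (rule continuous_on_compose2[OF _ continuous_on_of_real[OF continuous_on_id]]) simp
    then show ?thesis unfolding G_def by (rule continuous_on_Re)
  qed
  have injG: "inj_on G {a..b}"
  proof (rule inj_onI)
    fix x y assume xy: "x \<in> {a..b}" "y \<in> {a..b}" "G x = G y"
    then have "g (of_real x) = g (of_real y)" by (simp add: gG)
    then have "complex_of_real x = of_real y"
      using inj_onD[OF inj] xy sub by blast
    then show "x = y" by simp
  qed
  have Gab: "G a < G b" using inc by (simp add: G_def)
  \<comment> \<open>The monotonicity result used compares an interior point with the two ends only.
    It is applied on [a, b] to place \<open>G y\<close> above \<open>G a\<close>, and then on [a, y]
    to compare x with y.\<close>
  have strict: "G x < G y" if xy: "x \<in> {a..b}" "y \<in> {a..b}" "x < y" for x y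
  proof -
    have above: "G a < G y"
    proof (cases "y = b")
      case False
      then show ?thesis
        using continuous_inj_imp_mono[OF _ _ contG injG, of y] xy Gab by auto
    qed (use Gab in simp)
    show ?thesis
    proof (cases "x = a")
      case False
      have "continuous_on {a..y} G" "inj_on G {a..y}"
        using contG injG xy by (auto intro: continuous_on_subset inj_on_subset)
      then show ?thesis
        using continuous_inj_imp_mono[of a x y G] False xy above by auto
    qed (use above in simp)
  qed
  have mono: "G x \<le> G y" if "x \<in> {a..b}" "y \<in> {a..b}" "x \<le> y" for x y
    using strict[of x y] that by (cases "x = y") auto
  have seg: "compact (complex_of_real ` {c..d})" "convex (complex_of_real ` {c..d})" for c d
    by (auto intro!: compact_continuous_image continuous_intros convex_linear_image
        simp: bounded_linear.linear bounded_linear_of_real)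
  obtain h where h: "h holomorphic_on g ` S" "\<And>z. z \<in> S \<Longrightarrow> h (g z) = z"
    using holomorphic_has_inverse[OF hol S inj] by metis
  \<comment> \<open>The Lipschitz estimate for the inverse needs a whole convex segment inside its
    domain; the intermediate value theorem shows that every value in between is attained.\<close>
  have im: "complex_of_real ` {G a..G b} \<subseteq> g ` S"
  proof
    fix w assume "w \<in> complex_of_real ` {G a..G b}"
    then obtain v where v: "w = of_real v" "G a \<le> v" "v \<le> G b" by auto
    obtain x where x: "a \<le> x" "x \<le> b" "G x = v"
      using IVT'[of G a v b] v ab contG by auto
    then have "w = g (of_real x)" "of_real x \<in> S" using v gG[of x] sub by auto
    then show "w \<in> g ` S" by (rule image_eqI)
  qed
  obtain M where M: "0 < M"
    "\<And>x y. x \<in> complex_of_real ` {a..b} \<Longrightarrow> y \<in> complex_of_real ` {a..b} \<Longrightarrow> cmod (g x - g y) \<le> M * cmod (x - y)"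
    using holomorphic_lipschitz_on_compact_convex[OF S hol seg sub] by blast
  obtain B where B: "0 < B"
    "\<And>x y. x \<in> complex_of_real ` {G a..G b} \<Longrightarrow> y \<in> complex_of_real ` {G a..G b} \<Longrightarrow> cmod (h x - h y) \<le> B * cmod (x - y)"
    using holomorphic_lipschitz_on_compact_convex[OF open_mapping_thm3[OF hol S inj] h(1) seg im] by blast
  have "increasing_bilipschitz (1 / B) M {a..b} G"
    unfolding increasing_bilipschitz_def
  proof (intro conjI ballI impI)
    show "0 < 1 / B" using B by simp
    fix x y assume xy: "x \<in> {a..b}" "y \<in> {a..b}" "x \<le> y"
    have norm_eq: "cmod (of_real v - of_real u) = v - u" if "u \<le> v" for u v
      using that by (simp flip: of_real_diff)
    have G_xy: "G x \<le> G y" "G x \<in> {G a..G b}" "G y \<in> {G a..G b}"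
      using mono xy by auto
    have "cmod (of_real (G y) - of_real (G x)) \<le> M * cmod (of_real y - of_real x)"
      using M(2)[of "of_real y" "of_real x"] xy by (simp add: gG)
    then show "G y - G x \<le> M * (y - x)"
      by (simp only: norm_eq G_xy xy)
    have "complex_of_real x \<in> S" "complex_of_real y \<in> S" using xy sub by auto
    then have "h (of_real (G x)) = of_real x" "h (of_real (G y)) = of_real y"
      using h(2)[of "of_real x"] h(2)[of "of_real y"] xy by (auto simp: gG)
    then have "cmod (of_real y - of_real x) \<le> B * cmod (of_real (G y) - of_real (G x))"
      using B(2)[of "of_real (G y)" "of_real (G x)"] G_xy by simp
    then have "y - x \<le> B * (G y - G x)"
      by (simp only: norm_eq G_xy xy)
    then show "1 / B * (y - x) \<le> G y - G x"
      using B by (simp add: field_simps)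
  qed
  then show ?thesis using that unfolding G_def by blast
qed

lemma interval_conformal_map_bilipschitz:
  assumes "interval_conformal_map g"
  obtains m M where "increasing_bilipschitz m M {0..2} (\<lambda>x. Re (g (of_real x)))"
proof -
  obtain S where S: "open S" "g holomorphic_on S" "inj_on g S" "complex_of_real ` {0..2} \<subseteq> S"
    and im: "g ` complex_of_real ` {0..2} = complex_of_real ` {0..2}" and g: "g 0 = 0" "g 2 = 2"
    using assms unfolding interval_conformal_map_def by blast
  have "g (of_real x) \<in> \<real>" if "x \<in> {0..2}" for x
  proof -
    have "g (of_real x) \<in> complex_of_real ` {0..2}" using that im by blast
    then show ?thesis by auto
  qed
  then show ?thesis
    using conformal_increasing_bilipschitz[OF S(1-4)] g that by auto
qed

text \<open>Orientation and the value at 0 have to be derived. Two periods raise the value by 4 pi,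
  which excludes a decreasing map; and 0 is attained on [0, 2 pi), where the increasing map is
  nonnegative and smallest at 0.\<close>

lemma periodic_conformal_map_bilipschitz:
  assumes "periodic_conformal_map g"
  obtains m M where "increasing_bilipschitz m M {0..4 * pi} (\<lambda>x. Re (g (of_real x)))"
    "Re (g 0) = 0" "\<And>x. Re (g (of_real (x + 2 * pi))) = Re (g (of_real x)) + 2 * pi"
proof -
  obtain a where a: "0 < a" and hol: "g holomorphic_on {z. \<bar>Im z\<bar> \<le> a}" and inj: "inj_on g {z. \<bar>Im z\<bar> \<le> a}"
    and real: "\<And>x::real. g (complex_of_real x) \<in> \<real>"
    and im: "g ` complex_of_real ` {0..<2 * pi} = complex_of_real ` {0..<2 * pi}"
    and per: "\<And>x::real. g (complex_of_real (x + 2 * pi)) = g (complex_of_real x) + 2 * complex_of_real pi"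
    using assms unfolding periodic_conformal_map_def by blast
  \<comment> \<open>The open strip, because the holomorphic inverse requires an open domain.\<close>
  define S where "S = {z. \<bar>Im z\<bar> < a}"
  have S: "open S" "g holomorphic_on S" "inj_on g S" "complex_of_real ` {0..4 * pi} \<subseteq> S"
    using hol inj a unfolding S_def
    by (auto intro!: open_Collect_less continuous_intros
        elim!: holomorphic_on_subset inj_on_subset)
  have perRe: "Re (g (of_real (x + 2 * pi))) = Re (g (of_real x)) + 2 * pi" for x
    unfolding per by simp
  have inc: "Re (g (of_real 0)) < Re (g (of_real (4 * pi)))"
    using perRe[of 0] perRe[of "2 * pi"] pi_gt_zero by (simp add: mult_2[symmetric])
  obtain m M where G: "increasing_bilipschitz m M {0..4 * pi} (\<lambda>x. Re (g (of_real x)))"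
    using conformal_increasing_bilipschitz[OF S _ real inc] pi_gt_zero by auto
  have "g (complex_of_real 0) \<in> complex_of_real ` {0..<2 * pi}" using im pi_gt_zero by auto
  then have g0: "0 \<le> Re (g (complex_of_real 0))" by auto
  have "complex_of_real 0 \<in> g ` complex_of_real ` {0..<2 * pi}"
    unfolding im using pi_gt_zero by (intro imageI) auto
  then obtain x where x: "0 \<le> x" "x < 2 * pi" "g (of_real x) = 0" by force
  have "Re (g (of_real 0)) \<le> Re (g (of_real x))"
    using increasing_bilipschitz_mono[OF G, of 0 x] x pi_gt_zero by simp
  then have "Re (g 0) = 0" using g0 x by simp
  then show ?thesis using that[OF G] perRe by blast
qed

section \<open>From univariate bounds to the tensor product\<close>

lemma bigo_log_logI:
  assumes rat: "\<exists>A. \<forall>n\<ge>3. \<forall>t\<in>{0..2}. (\<Sum>k\<le>n. \<bar>rat_basis n (y n) k t\<bar>) \<le> A * ln (real n)"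
    and trig: "\<exists>A N. \<forall>n\<ge>N. \<forall>\<phi>\<in>{0..<2 * pi}. (\<Sum>k<n. \<bar>trig_basis n (p n) k \<phi>\<bar>) \<le> A * ln (real n)"
  shows "bigo_log_log (\<lambda>n1 n2. lebesgue_const n1 n2 (y n1) (p n2))"
proof -
  obtain A where A: "\<And>n t. 3 \<le> n \<Longrightarrow> t \<in> {0..2} \<Longrightarrow> (\<Sum>k\<le>n. \<bar>rat_basis n (y n) k t\<bar>) \<le> A * ln (real n)"
    using rat by blast
  obtain B N where B: "\<And>n \<phi>. N \<le> n \<Longrightarrow> \<phi> \<in> {0..<2 * pi} \<Longrightarrow> (\<Sum>k<n. \<bar>trig_basis n (p n) k \<phi>\<bar>) \<le> B * ln (real n)"
    using trig by blast
  \<comment> \<open>The lower bound, from the value at (0, 0), excludes minus infinity and removes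
    the absolute value when passing from \<open>ereal\<close> to \<open>real\<close>.\<close>
  have bounds: "0 \<le> lebesgue_const n1 n2 (y n1) (p n2) \<and>
      lebesgue_const n1 n2 (y n1) (p n2) \<le> ereal ((A * B) * (ln (real n1) * ln (real n2)))"
    if n: "max 3 N \<le> n1" "max 3 N \<le> n2" for n1 n2
  proof
    define L where "L t \<phi> = (\<Sum>i\<le>n1. \<Sum>j<n2. \<bar>rat_basis n1 (y n1) i t\<bar> * \<bar>trig_basis n2 (p n2) j \<phi>\<bar>)" for t \<phi>
    have "0 \<le> ereal (L 0 0)"
      unfolding L_def by (auto intro!: sum_nonneg)
    also have "\<dots> \<le> lebesgue_const n1 n2 (y n1) (p n2)"
      unfolding lebesgue_const_def L_def by (rule SUP_upper2[of "(0, 0)"]) auto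
    finally show "0 \<le> lebesgue_const n1 n2 (y n1) (p n2)" .
    have "L t \<phi> \<le> (A * B) * (ln (real n1) * ln (real n2))" if "t \<in> {0..2}" "\<phi> \<in> {0..<2 * pi}" for t \<phi>
    proof -
      have "L t \<phi> = (\<Sum>i\<le>n1. \<bar>rat_basis n1 (y n1) i t\<bar>) * (\<Sum>j<n2. \<bar>trig_basis n2 (p n2) j \<phi>\<bar>)"
        by (simp add: L_def sum_product)
      also have "\<dots> \<le> (A * ln (real n1)) * (B * ln (real n2))"
      proof (rule mult_mono)
        \<comment> \<open>The sign of \<open>A\<close> is not given; that
          \<open>A * ln (real n1)\<close> is nonnegative follows from its bounding a sum of absolute
          values.\<close>
        have "0 \<le> (\<Sum>i\<le>n1. \<bar>rat_basis n1 (y n1) i t\<bar>)" by (intro sum_nonneg) auto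
        also have "\<dots> \<le> A * ln (real n1)" using A[of n1 t] n that by simp
        finally show "0 \<le> A * ln (real n1)" .
      qed (use A B n that in \<open>auto intro!: sum_nonneg\<close>)
      finally show ?thesis by (simp add: mult_ac)
    qed
    then show "lebesgue_const n1 n2 (y n1) (p n2) \<le> ereal ((A * B) * (ln (real n1) * ln (real n2)))"
      unfolding lebesgue_const_def L_def by (auto intro!: SUP_least)
  qed
  show ?thesis
    unfolding bigo_log_log_def
  proof (intro conjI bigoI[where c = "A * B"])
    have finite: "\<bar>lebesgue_const n1 n2 (y n1) (p n2)\<bar> \<noteq> \<infinity>" if "max 3 N \<le> n1" "max 3 N \<le> n2" for n1 n2
      using bounds[OF that] by (cases "lebesgue_const n1 n2 (y n1) (p n2)") auto
    show "\<forall>\<^sub>F (n1, n2) in sequentially \<times>\<^sub>F sequentially. \<bar>lebesgue_const n1 n2 (y n1) (p n2)\<bar> \<noteq> \<infinity>"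
      unfolding eventually_prod_sequentially prod.case using finite by (intro exI allI impI)
    have "\<bar>real_of_ereal (lebesgue_const n1 n2 (y n1) (p n2))\<bar> \<le> A * B * \<bar>ln (real n1) * ln (real n2)\<bar>"
      if "max 3 N \<le> n1" "max 3 N \<le> n2" for n1 n2
    proof -
      have "0 \<le> ln (real n1) * ln (real n2)" using that by simp
      then show ?thesis
        using bounds[OF that] by (cases "lebesgue_const n1 n2 (y n1) (p n2)") auto
    qed
    then show "\<forall>\<^sub>F x in sequentially \<times>\<^sub>F sequentially.
        norm (case x of (n1, n2) \<Rightarrow> real_of_ereal (lebesgue_const n1 n2 (y n1) (p n2))) \<le>
        A * B * norm (case x of (n1, n2) \<Rightarrow> ln (real n1) * ln (real n2))"
      unfolding eventually_prod_sequentially by (auto intro!: exI[of _ "max 3 N"])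
  qed
qed

theorem theorem7:
  shows "bigo_log_log (\<lambda>n1 n2. lebesgue_const n1 n2 (cheb_node n1) (equi_node n2)) \<and>
         (\<forall>g1 g2. interval_conformal_map g1 \<longrightarrow> periodic_conformal_map g2 \<longrightarrow>
            bigo_log_log (\<lambda>n1 n2. lebesgue_const n1 n2
              (\<lambda>i. Re (g1 (complex_of_real (cheb_node n1 i))))
              (\<lambda>j. Re (g2 (complex_of_real (equi_node n2 j))))))"
proof (intro conjI allI impI)
  \<comment> \<open>The unmapped nodes are the case of the identity map, with both constants equal
    to 1.\<close>
  have id: "increasing_bilipschitz 1 1 S (\<lambda>x. x)" for S
    by (simp add: increasing_bilipschitz_def)
  show "bigo_log_log (\<lambda>n1 n2. lebesgue_const n1 n2 (cheb_node n1) (equi_node n2))"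
    using rat_basis_lebesgue_cheb[OF id] trig_basis_lebesgue_equi[OF id]
    by (intro bigo_log_logI) simp_all
next
  fix g1 g2 assume g: "interval_conformal_map g1" "periodic_conformal_map g2"
  obtain m1 M1 where g1: "increasing_bilipschitz m1 M1 {0..2} (\<lambda>x. Re (g1 (of_real x)))"
    using interval_conformal_map_bilipschitz[OF g(1)] by blast
  have g1_ends: "Re (g1 (of_real 0)) = 0" "Re (g1 (of_real 2)) = 2"
    using g(1) by (auto simp: interval_conformal_map_def)
  obtain m2 M2 where g2: "increasing_bilipschitz m2 M2 {0..4 * pi} (\<lambda>x. Re (g2 (of_real x)))"
    "Re (g2 0) = 0" "\<And>x. Re (g2 (of_real (x + 2 * pi))) = Re (g2 (of_real x)) + 2 * pi"
    using periodic_conformal_map_bilipschitz[OF g(2)] by blast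
  show "bigo_log_log (\<lambda>n1 n2. lebesgue_const n1 n2
      (\<lambda>i. Re (g1 (complex_of_real (cheb_node n1 i)))) (\<lambda>j. Re (g2 (complex_of_real (equi_node n2 j)))))"
    using rat_basis_lebesgue_cheb[OF g1 g1_ends] trig_basis_lebesgue_equi[OF g2(1) _ g2(3)] g2(2)
    by (intro bigo_log_logI) simp_all
qed

end
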